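(* Suppose $G = K_{n_1, \ldots, n_t}$ with $t, n_1, \ldots, n_t \in \mathbb{N}$ and $t \geq 2$, and let $s = \sum_{i=1}^t \lceil n_i/2 \rceil$. Then $G$ is not proportionally $(s-1)$-choosable. Consequently, $\chi_{pc}(K_{n_1,\ldots,n_t}) \geq \sum_{i=1}^t \lceil n_i/2 \rceil$.
   Context: All graphs are finite and simple; $\mathbb{N}=\{1,2,3,\ldots\}$. $K_{n_1,\ldots,n_t}$ denotes the complete $t$-partite graph with partite sets of sizes $n_1,\ldots,n_t$. A list assignment $L$ for a graph $G$ assigns to each vertex $v$ a set $L(v)$ of colors; it is a $k$-assignment if $|L(v)|=k$ for all $v$. The palette is $\mathcal{L}=\bigcup_{v}L(v)$. A proper $L$-coloring is a proper coloring $f$ with $f(v)\in L(v)$ for all $v$. For $c\in\mathcal{L}$, $\eta(c)$ is the number of vertices $v$ with $c\in L(v)$. If $L$ is a $k$-assignment, a proper $L$-coloring $f$ is a proportional $L$-coloring if for every $c\in\mathcal{L}$, $|f^{-1}(c)|\in\{\lfloor \eta(c)/k\rfloor,\lceil \eta(c)/k\rceil\}$. $G$ is proportionally $k$-choosable if it has a proportional $L$-coloring for every $k$-assignment $L$; $\chi_{pc}(G)$ is the smallest $k$ such that $G$ is proportionally $k$-choosable. *)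

theory Defs
  imports Complex_Main "HOL-Library.Disjoint_Sets" "Graph_Theory.Digraph"
begin

text \<open>
  Finite simple graphs are the loop-free symmetric digraphs without multiple arcs of the
  locale \<^locale>\<open>graph\<close>; two vertices are adjacent iff \<open>u \<rightarrow>\<^bsub>G\<^esub> v\<close>.
\<close>

text \<open>
  \<open>G\<close> is a copy of \<open>K\<^bsub>n 1, \<dots>, n t\<^esub>\<close>, with partite sets \<open>P 1, \<dots>, P t\<close>
  (a definition up to isomorphism, as for the complete bipartite graphs of \<open>Graph_Theory.Kuratowski\<close>).
\<close>
definition complete_multipartite ::
    "nat \<Rightarrow> (nat \<Rightarrow> nat) \<Rightarrow> ('a, 'b) pre_digraph \<Rightarrow> bool" where
  "complete_multipartite t n G \<longleftrightarrow> graph G \<and>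
     (\<exists>P. disjoint_family_on P {1..t} \<and> (\<forall>i\<in>{1..t}. card (P i) = n i) \<and>
          verts G = (\<Union>i\<in>{1..t}. P i) \<and>
          arcs_ends G = (\<Union>i\<in>{1..t}. \<Union>j\<in>{1..t} - {i}. P i \<times> P j))"

definition k_assignment :: "nat \<Rightarrow> ('a, 'b) pre_digraph \<Rightarrow> ('a \<Rightarrow> 'c set) \<Rightarrow> bool" where
  "k_assignment k G L \<longleftrightarrow> (\<forall>v\<in>verts G. finite (L v) \<and> card (L v) = k)"

definition palette :: "('a, 'b) pre_digraph \<Rightarrow> ('a \<Rightarrow> 'c set) \<Rightarrow> 'c set" where
  "palette G L = (\<Union>v\<in>verts G. L v)"

definition proper_coloring :: "('a, 'b) pre_digraph \<Rightarrow> ('a \<Rightarrow> 'c) \<Rightarrow> bool" where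
  "proper_coloring G f \<longleftrightarrow> (\<forall>u v. u \<rightarrow>\<^bsub>G\<^esub> v \<longrightarrow> f u \<noteq> f v)"

definition proper_list_coloring ::
    "('a, 'b) pre_digraph \<Rightarrow> ('a \<Rightarrow> 'c set) \<Rightarrow> ('a \<Rightarrow> 'c) \<Rightarrow> bool" where
  "proper_list_coloring G L f \<longleftrightarrow> proper_coloring G f \<and> (\<forall>v\<in>verts G. f v \<in> L v)"

definition eta :: "('a, 'b) pre_digraph \<Rightarrow> ('a \<Rightarrow> 'c set) \<Rightarrow> 'c \<Rightarrow> nat" where
  "eta G L c = card {v \<in> verts G. c \<in> L v}"

definition proportional_coloring ::
    "nat \<Rightarrow> ('a, 'b) pre_digraph \<Rightarrow> ('a \<Rightarrow> 'c set) \<Rightarrow> ('a \<Rightarrow> 'c) \<Rightarrow> bool" where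
  "proportional_coloring k G L f \<longleftrightarrow> proper_list_coloring G L f \<and>
     (\<forall>c\<in>palette G L. int (card {v \<in> verts G. f v = c})
        \<in> {\<lfloor>real (eta G L c) / real k\<rfloor>, \<lceil>real (eta G L c) / real k\<rceil>})"

text \<open>
  Colors are natural numbers. This loses no generality: a finite graph with finite lists
  has a finite palette, and only equality of colors matters.
\<close>
definition proportionally_choosable :: "nat \<Rightarrow> ('a, 'b) pre_digraph \<Rightarrow> bool" where
  "proportionally_choosable k G \<longleftrightarrow>
     (\<forall>L :: 'a \<Rightarrow> nat set. k_assignment k G L \<longrightarrow> (\<exists>f. proportional_coloring k G L f))"

text \<open>
  The minimum exists for every finite graph: if \<open>k\<close> exceeds the number of vertices, then
  an injective choice of colors from the lists is proportional.
\<close>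
definition chi_pc :: "('a, 'b) pre_digraph \<Rightarrow> nat" where
  "chi_pc G = (LEAST k. 1 \<le> k \<and> proportionally_choosable k G)"

end

theory Submission
  imports Defs
begin

text \<open>
  For \<open>1 \<le> k < s\<close>, choose \<open>W i \<subseteq> P i\<close> of size \<open>m i\<close> such that \<open>W = \<Union>i. W i\<close> has at most
  \<open>2 k\<close> elements and \<open>\<Sum>i. \<lceil>m i / 2\<rceil> > k\<close>: start with one vertex from each of two parts
  and repeatedly enlarge some part by two vertices, or by one if only one is left.
  Give all vertices of \<open>W\<close> the same list of \<open>k\<close> colors, and all other vertices a list of \<open>k\<close>
  further colors. In a proportional coloring each of the first \<open>k\<close> colors is used at most twice,
  and only inside one part, so part \<open>i\<close> takes at least \<open>\<lceil>m i / 2\<rceil>\<close> of them. That is more than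
  \<open>k\<close> in total.
\<close>

lemma nat_ceiling_half: "nat \<lceil>real n / 2\<rceil> = (n + 1) div 2"
proof -
  have "\<lceil>real n / 2\<rceil> = int ((n + 1) div 2)"
    by (cases "even n") (auto elim!: evenE oddE simp: ceiling_unique)
  then show ?thesis by simp
qed

text \<open>In the induction on \<open>k\<close> the bound on the number of vertices grows by two,
  while the sum of rounded halves has to grow by one only. Enlarging a single part achieves
  both.\<close>

lemma exists_small_parts:
  fixes n :: "nat \<Rightarrow> nat"
  assumes t: "t \<ge> 2" and pos: "\<And>i. i \<in> {1..t} \<Longrightarrow> n i \<ge> 1"
    and k: "1 \<le> k" "k < (\<Sum>i=1..t. (n i + 1) div 2)"
  shows "\<exists>m. (\<forall>i\<in>{1..t}. m i \<le> n i) \<and> (\<Sum>i=1..t. m i) \<le> 2 * k \<and>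
             k < (\<Sum>i=1..t. (m i + 1) div 2)"
  using k
proof (induction k rule: dec_induct)
  case base
  have split: "{1..t} = insert 1 (insert 2 {3..t})" using t by auto
  have "(\<Sum>i=1..t. if i \<le> 2 then 1 else 0 :: nat) = 2"
    "(\<Sum>i=1..t. ((if i \<le> 2 then 1 else 0) + 1) div 2 :: nat) = 2"
    unfolding split by auto
  then show ?case
    using pos by (intro exI[of _ "\<lambda>i. if i \<le> 2 then 1 else 0"]) auto
next
  case (step k)
  from step.IH[OF Suc_lessD[OF step.prems]]
  obtain m where m: "\<And>i. i \<in> {1..t} \<Longrightarrow> m i \<le> n i" "(\<Sum>i=1..t. m i) \<le> 2 * k"
      "k < (\<Sum>i=1..t. (m i + 1) div 2)"
    by blast
  show ?case
  proof (cases "Suc k < (\<Sum>i=1..t. (m i + 1) div 2)")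
    case True
    then show ?thesis using m by (intro exI[of _ m]) auto
  next
    case False
    \<comment> \<open>The sum for \<open>m\<close> is now exactly \<open>Suc k\<close>, which is
      less than the sum for \<open>n\<close>. Hence some part still has room.\<close>
    then have "(\<Sum>i=1..t. (m i + 1) div 2) < (\<Sum>i=1..t. (n i + 1) div 2)"
      using step.prems by simp
    then obtain i where i: "i \<in> {1..t}" "(m i + 1) div 2 < (n i + 1) div 2"
      by (meson linorder_not_less sum_mono)
    \<comment> \<open>If only one vertex is left, then \<open>n i = m i + 1\<close>, and the choice
      of \<open>i\<close> forces \<open>m i\<close> to be even. So this vertex alone raises the
      rounded half.\<close>
    define m' where "m' = m(i := min (n i) (m i + 2))"
    define h :: "nat \<Rightarrow> nat" where "h x = (x + 1) div 2" for x
    have rest: "(\<Sum>j\<in>{1..t} - {i}. g (m' j)) = (\<Sum>j\<in>{1..t} - {i}. g (m j))" for g :: "nat \<Rightarrow> nat"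
      by (rule sum.cong) (auto simp: m'_def)
    \<comment> \<open>Used with the identity for the sizes and with \<open>h\<close> for the rounded
      halves. Additions on both sides avoid truncated subtraction.\<close>
    have total: "(\<Sum>j=1..t. g (m' j)) + g (m i) = (\<Sum>j=1..t. g (m j)) + g (m' i)"
      for g :: "nat \<Rightarrow> nat"
      using rest[of g] sum.remove[OF _ i(1), of "\<lambda>j. g (m' j)"]
        sum.remove[OF _ i(1), of "\<lambda>j. g (m j)"] by simp
    have "m' i \<le> m i + 2" "h (m i) < h (m' i)"
      using i(2) by (auto simp: h_def m'_def min_def)
    then have "(\<Sum>j=1..t. m' j) \<le> 2 * Suc k" and "Suc k < (\<Sum>j=1..t. h (m' j))"
      using m(2) m(3)[folded h_def] total[of "\<lambda>x. x"] total[of h] by simp_all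
    moreover have "\<forall>j\<in>{1..t}. m' j \<le> n j" using m(1) by (auto simp: m'_def)
    ultimately show ?thesis unfolding h_def by blast
  qed
qed

text \<open>The fibers partition \<open>A\<close>, so \<open>card A\<close> is at most twice the
  number of values. Integrality gives the rounding up.\<close>

lemma card_image_ge_half:
  assumes "finite A" "\<And>c. c \<in> f ` A \<Longrightarrow> card {a \<in> A. f a = c} \<le> 2"
  shows "(card A + 1) div 2 \<le> card (f ` A)"
proof -
  have "card A = (\<Sum>c\<in>f ` A. card {a \<in> A. f a = c})"
    using sum.image_gen[OF assms(1), of "\<lambda>_. 1::nat" f] by simp
  also have "\<dots> \<le> (\<Sum>c\<in>f ` A. 2)" by (intro sum_mono assms(2))
  finally show ?thesis by simp
qed

lemma not_proportionally_choosable_below: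
  fixes G :: "('a, 'b) pre_digraph" and n :: "nat \<Rightarrow> nat"
  assumes t: "t \<ge> 2" and pos: "\<And>i. i \<in> {1..t} \<Longrightarrow> n i \<ge> 1"
    and G: "complete_multipartite t n G"
    and k: "1 \<le> k" "k < (\<Sum>i=1..t. (n i + 1) div 2)"
  shows "\<not> proportionally_choosable k G"
proof
  assume choosable: "proportionally_choosable k G"
  obtain P where "graph G" and disj: "disjoint_family_on P {1..t}"
    and cardP: "\<forall>i\<in>{1..t}. card (P i) = n i"
    and verts: "verts G = (\<Union>i\<in>{1..t}. P i)"
    and arcs: "arcs_ends G = (\<Union>i\<in>{1..t}. \<Union>j\<in>{1..t} - {i}. P i \<times> P j)"
    using G unfolding complete_multipartite_def by (elim conjE exE) (rule that)
  interpret graph G by fact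
  obtain m where m: "\<And>i. i \<in> {1..t} \<Longrightarrow> m i \<le> n i" "(\<Sum>i=1..t. m i) \<le> 2 * k"
      "k < (\<Sum>i=1..t. (m i + 1) div 2)"
    using exists_small_parts[OF t pos k] by blast
  have "\<exists>S. S \<subseteq> P i \<and> card S = m i" if "i \<in> {1..t}" for i
    using m(1)[OF that] bspec[OF cardP that] by (metis obtain_subset_with_card_n)
  then obtain S where S: "\<And>i. i \<in> {1..t} \<Longrightarrow> S i \<subseteq> P i" "\<And>i. i \<in> {1..t} \<Longrightarrow> card (S i) = m i"
    by metis
  define W where "W = (\<Union>i\<in>{1..t}. S i)"
  have W: "W \<subseteq> verts G" using S(1) unfolding verts W_def by blast
  have S_W: "S i \<subseteq> W" if "i \<in> {1..t}" for i using that unfolding W_def by blast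
  have finS: "finite (S i)" if "i \<in> {1..t}" for i
    using S_W[OF that] W finite_verts by (meson finite_subset)
  have "card W \<le> (\<Sum>i=1..t. card (S i))" unfolding W_def by (rule card_UN_le) simp
  also have "\<dots> \<le> 2 * k" using S(2) m(2) by simp
  finally have cardW: "card W \<le> 2 * k" .
  \<comment> \<open>The two color blocks are disjoint, so a color below \<open>k\<close> lies
    exactly in the lists of \<open>W\<close>, and its \<open>eta\<close> is
    \<open>card W\<close>.\<close>
  define L where "L v = (if v \<in> W then {..<k} else {k..<2 * k})" for v
  have "k_assignment k G L" by (auto simp: k_assignment_def L_def)
  then obtain f where f: "proportional_coloring k G L f"
    using choosable unfolding proportionally_choosable_def by blast
  have f_L: "f v \<in> L v" if "v \<in> verts G" for v
    using f that by (auto simp: proportional_coloring_def proper_list_coloring_def)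
  \<comment> \<open>A color used on \<open>W\<close> lies below \<open>k\<close> and in the palette,
    so proportionality bounds its use by the ceiling of \<open>card W / k\<close>.\<close>
  have at_most_twice: "card {v \<in> verts G. f v = c} \<le> 2" if "c \<in> f ` W" for c
  proof -
    have c: "c < k" "c \<in> palette G L"
      using that f_L W by (fastforce simp: L_def palette_def)+
    have "{v \<in> verts G. c \<in> L v} = W" using c W by (auto simp: L_def)
    then have "real (eta G L c) / real k \<le> 2"
      using cardW k by (simp add: eta_def divide_simps)
    then have "\<lceil>real (eta G L c) / real k\<rceil> \<le> 2" by (simp add: ceiling_le_iff)
    moreover have "\<lfloor>real (eta G L c) / real k\<rfloor> \<le> \<lceil>real (eta G L c) / real k\<rceil>"
      by (rule floor_le_ceiling)
    moreover have "int (card {v \<in> verts G. f v = c})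
        \<in> {\<lfloor>real (eta G L c) / real k\<rfloor>, \<lceil>real (eta G L c) / real k\<rceil>}"
      using f c(2) unfolding proportional_coloring_def by blast
    ultimately have "int (card {v \<in> verts G. f v = c}) \<le> 2"
      by (elim insertE emptyE) linarith+
    then show ?thesis by simp
  qed
  have half: "(m i + 1) div 2 \<le> card (f ` S i)" if i: "i \<in> {1..t}" for i
  proof -
    have "card {v \<in> S i. f v = c} \<le> 2" if "c \<in> f ` S i" for c
    proof -
      have "card {v \<in> S i. f v = c} \<le> card {v \<in> verts G. f v = c}"
        using S_W[OF i] W by (intro card_mono) auto
      also have "\<dots> \<le> 2" using S_W[OF i] that by (intro at_most_twice) blast
      finally show ?thesis .
    qed
    then show ?thesis using card_image_ge_half[OF finS[OF i], of f] S(2)[OF i] by simp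
  qed
  have "f u \<noteq> f v" if "i \<in> {1..t}" "j \<in> {1..t}" "i \<noteq> j" "u \<in> S i" "v \<in> S j" for i j u v
  proof -
    have "u \<rightarrow>\<^bsub>G\<^esub> v" using that S(1) unfolding arcs by blast
    then show ?thesis
      using f unfolding proportional_coloring_def proper_list_coloring_def proper_coloring_def
      by blast
  qed
  then have disjoint_colors:
    "\<forall>i\<in>{1..t}. \<forall>j\<in>{1..t}. i \<noteq> j \<longrightarrow> f ` S i \<inter> f ` S j = {}" by blast
  \<comment> \<open>The parts use pairwise disjoint sets of colors below \<open>k\<close>, so the
    sizes of these sets add up to at most \<open>k\<close>, against the choice of
    \<open>m\<close>.\<close>
  have "(\<Sum>i=1..t. (m i + 1) div 2) \<le> (\<Sum>i=1..t. card (f ` S i))" by (intro sum_mono half)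
  also have "\<dots> = card (\<Union>i\<in>{1..t}. f ` S i)"
    using disjoint_colors finS by (subst card_UN_disjoint) auto
  also have "\<dots> \<le> card {..<k}"
  proof (intro card_mono UN_least image_subsetI)
    fix i v assume "i \<in> {1..t}" "v \<in> S i"
    then have "v \<in> W" using S_W by blast
    then show "f v \<in> {..<k}" using f_L[of v] W by (auto simp: L_def)
  qed simp
  finally show False using m(3) by simp
qed

text \<open>Greedy choice: fewer colors are taken by the earlier elements than the next list
  contains.\<close>

lemma exists_injective_choice:
  assumes "finite A" "\<And>a. a \<in> A \<Longrightarrow> card A \<le> card (L a)"
  shows "\<exists>f. inj_on f A \<and> (\<forall>a\<in>A. f a \<in> L a)"
  using assms
proof (induction A)
  case empty
  then show ?case by simp
next
  case (insert a A)
  have "card A \<le> card (L b)" if "b \<in> A" for b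
    using insert.prems[of b] insert.hyps that by simp
  then obtain f where f: "inj_on f A" "\<forall>b\<in>A. f b \<in> L b" using insert.IH by blast
  have "card (f ` A) < card (L a)"
    using insert.prems[of a] insert.hyps card_image_le[of A f] by simp
  then have "\<not> L a \<subseteq> f ` A" using insert.hyps(1) by (metis card_mono finite_imageI not_le)
  then obtain c where c: "c \<in> L a" "c \<notin> f ` A" by blast
  have "inj_on (f(a := c)) (insert a A)"
    using f(1) c(2) insert.hyps(2) by (auto simp: inj_on_def)
  moreover have "\<forall>b\<in>insert a A. (f(a := c)) b \<in> L b" using f(2) c(1) by auto
  ultimately show ?case by blast
qed

text \<open>Each palette color has \<open>0 < eta < k\<close>, so it may be used zero times or once,
  as an injective coloring does. The inequality is strict because a color with
  \<open>eta = k\<close> would have to be used exactly once.\<close>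

lemma (in graph) proportionally_choosable_large:
  assumes k: "card (verts G) < k"
  shows "proportionally_choosable k G"
  unfolding proportionally_choosable_def
proof (intro allI impI)
  fix L :: "'a \<Rightarrow> nat set"
  assume L: "k_assignment k G L"
  have "card (verts G) \<le> card (L v)" if "v \<in> verts G" for v
    using L k that by (simp add: k_assignment_def)
  then obtain f where inj: "inj_on f (verts G)" and f: "\<forall>v\<in>verts G. f v \<in> L v"
    using exists_injective_choice[OF finite_verts] by blast
  have "proper_coloring G f"
    unfolding proper_coloring_def
  proof (intro allI impI)
    fix u v assume "u \<rightarrow>\<^bsub>G\<^esub> v"
    then show "f u \<noteq> f v" using inj adj_not_same adj_in_verts by (metis inj_onD)
  qed
  moreover have "int (card {v \<in> verts G. f v = c})
      \<in> {\<lfloor>real (eta G L c) / real k\<rfloor>, \<lceil>real (eta G L c) / real k\<rceil>}"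
    if c: "c \<in> palette G L" for c
  proof -
    have "eta G L c \<le> card (verts G)" unfolding eta_def by (intro card_mono) auto
    then have "eta G L c < k" using k by simp
    moreover have "0 < eta G L c" using c by (auto simp: eta_def palette_def card_gt_0_iff)
    ultimately have "0 < real (eta G L c) / real k" "real (eta G L c) / real k < 1"
      by (auto simp: divide_simps)
    then have "\<lfloor>real (eta G L c) / real k\<rfloor> = 0" "\<lceil>real (eta G L c) / real k\<rceil> = 1"
      by linarith+
    moreover have "card {v \<in> verts G. f v = c} \<le> 1"
      using inj by (auto simp: card_le_Suc0_iff_eq inj_on_def)
    then have "int (card {v \<in> verts G. f v = c}) \<in> {0, 1}" by (auto simp: le_Suc_eq)
    ultimately show ?thesis by simp
  qed
  ultimately show "\<exists>f. proportional_coloring k G L f"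
    using f unfolding proportional_coloring_def proper_list_coloring_def by blast
qed

theorem theorem7:
  fixes G :: "('a, 'b) pre_digraph" and t :: nat and n :: "nat \<Rightarrow> nat" and s :: nat
  assumes "t \<ge> 2"
    and "\<And>i. i \<in> {1..t} \<Longrightarrow> n i \<ge> 1"
    and "complete_multipartite t n G"
    and "s = (\<Sum>i=1..t. nat \<lceil>real (n i) / 2\<rceil>)"
  shows "\<not> proportionally_choosable (s - 1) G \<and> chi_pc G \<ge> s"
proof -
  have s: "s = (\<Sum>i=1..t. (n i + 1) div 2)"
    using assms(4) by (simp only: nat_ceiling_half)
  \<comment> \<open>Every part contributes at least one, so \<open>s - 1\<close> is positive and
    \<open>below\<close> applies to it.\<close>
  have "t = (\<Sum>i=1..t. 1)" by simp
  also have "\<dots> \<le> s" unfolding s using assms(2) by (intro sum_mono) fastforce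
  finally have "s \<ge> 2" using assms(1) by simp
  have below: "\<not> proportionally_choosable k G" if "1 \<le> k" "k < s" for k
    using not_proportionally_choosable_below[OF assms(1-3)] that s by blast
  interpret graph G using assms(3) by (simp add: complete_multipartite_def)
  have "1 \<le> chi_pc G \<and> proportionally_choosable (chi_pc G) G"
    unfolding chi_pc_def
    by (rule LeastI[of _ "Suc (card (verts G))"]) (simp add: proportionally_choosable_large)
  \<comment> \<open>All \<open>k\<close> from 1 to \<open>s - 1\<close> are excluded directly, so no
    monotonicity in \<open>k\<close> is invoked.\<close>
  then have "chi_pc G \<ge> s" using below not_less by blast
  then show ?thesis using below[of "s - 1"] \<open>s \<ge> 2\<close> by simp
qed

end
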